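(* $\mathcal{SDP}$ is a maximal $\omega$-clone in $\mathcal{SD}$; i.e., for any $n$-ary self-dual function $f\in\mathcal{SD}\setminus\mathcal{SDP}$, $\langle\mathcal{SDP}\cup\{f\}\rangle_\omega=\mathcal{SD}$.
   Context: $\mathcal{B}_k$ is the set of functions $\{0,1\}^k\to\mathbb{R}_{\ge0}$, $\mathcal{B}=\bigcup_k\mathcal{B}_k$; $|\mathbf{x}|$ Hamming weight, $\overline{\mathbf{x}}$ complement. Fourier transform: $\widehat f(\mathbf{x})=2^{-k}\sum_{\mathbf{w}\in\{0,1\}^k}(-1)^{|\mathbf{w}\wedge\mathbf{x}|}f(\mathbf{w})$. $\mathcal{SD}=\{f\in\mathcal{B}:f(\mathbf{x})=f(\overline{\mathbf{x}})\ \forall\mathbf{x}\}$ (self-dual functions); $\mathcal{P}=\{f\in\mathcal{B}:\widehat f\ge0\}$; $\mathcal{PN}=\{f\in\mathcal{B}:\widehat f(\mathbf{x})\ge0$ for $|\mathbf{x}|$ even, $\le0$ for $|\mathbf{x}|$ odd$\}$; $\mathcal{SDP}=\mathcal{SD}\cap\mathcal{P}\cap\mathcal{PN}$. $\mathrm{EQ}$ is the binary equality indicator. $\langle\mathcal{F}\rangle$ is the closure of $\mathcal{F}\cup\{\mathrm{EQ}\}$ under introducing fictitious arguments, permuting arguments, pointwise product of equal-arity functions, and summing out an argument over $\{0,1\}$; a $k$-ary $f$ is a limit of $\mathcal{F}$ if there is a finite $S\subseteq\mathcal{F}$ such that for all $\epsilon>0$ some $k$-ary $f_\epsilon\in\langle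 S\rangle$ has $\max_\mathbf{x}|f-f_\epsilon|<\epsilon$; $\langle\mathcal{F}\rangle_\omega$ is the closure of $\mathcal{F}\cup\{\mathrm{EQ}\}$ under the four operations and limits. *)

theory Defs
  imports Complex_Main "HOL-Library.FuncSet" "HOL-Combinatorics.Combinatorics"
begin

(* The argument values 0 and 1 are False and True. A function of arity k is a pair (k, f) with
   f extensional on the k-cube, so that equality of pairs is equality of functions with arity;
   arity 0 is included. *)

type_synonym bfun = "nat \<times> (bool list \<Rightarrow> real)"

definition cube :: "nat \<Rightarrow> bool list set" where
  "cube k = {x. length x = k}"

definition Bfuns :: "bfun set" where
  "Bfuns = (SIGMA k:UNIV. cube k \<rightarrow>\<^sub>E {0..})"

definition hamming_weight :: "bool list \<Rightarrow> nat" where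
  "hamming_weight x = count_list x True"

definition complement :: "bool list \<Rightarrow> bool list" where
  "complement x = map Not x"

definition meet :: "bool list \<Rightarrow> bool list \<Rightarrow> bool list" where
  "meet w x = map2 (\<and>) w x"

definition fourier :: "nat \<Rightarrow> (bool list \<Rightarrow> real) \<Rightarrow> bool list \<Rightarrow> real" where
  "fourier k f x = (\<Sum>w\<in>cube k. (-1) ^ hamming_weight (meet w x) * f w) / 2 ^ k"

definition SD :: "bfun set" where
  "SD = {(k, f) \<in> Bfuns. \<forall>x\<in>cube k. f x = f (complement x)}"

definition P_funs :: "bfun set" where
  "P_funs = {(k, f) \<in> Bfuns. \<forall>x\<in>cube k. fourier k f x \<ge> 0}"

definition PN_funs :: "bfun set" where
  "PN_funs = {(k, f) \<in> Bfuns. \<forall>x\<in>cube k.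
     (even (hamming_weight x) \<longrightarrow> fourier k f x \<ge> 0) \<and>
     (odd (hamming_weight x) \<longrightarrow> fourier k f x \<le> 0)}"

definition SDP :: "bfun set" where
  "SDP = SD \<inter> P_funs \<inter> PN_funs"

definition EQ :: bfun where
  "EQ = (2, \<lambda>x\<in>cube 2. if x ! 0 = x ! 1 then 1 else 0)"

(* Positions are counted from 0; an argument may be introduced or summed out at any position i. *)

definition fictitious :: "nat \<Rightarrow> nat \<Rightarrow> (bool list \<Rightarrow> real) \<Rightarrow> bfun" where
  "fictitious i k f = (Suc k, \<lambda>x\<in>cube (Suc k). f (take i x @ drop (Suc i) x))"

definition permute_args :: "(nat \<Rightarrow> nat) \<Rightarrow> nat \<Rightarrow> (bool list \<Rightarrow> real) \<Rightarrow> bfun" where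
  "permute_args \<pi> k f = (k, \<lambda>x\<in>cube k. f (permute_list \<pi> x))"

definition pointwise_product ::
    "nat \<Rightarrow> (bool list \<Rightarrow> real) \<Rightarrow> (bool list \<Rightarrow> real) \<Rightarrow> bfun" where
  "pointwise_product k f g = (k, \<lambda>x\<in>cube k. f x * g x)"

definition sum_out :: "nat \<Rightarrow> nat \<Rightarrow> (bool list \<Rightarrow> real) \<Rightarrow> bfun" where
  "sum_out i k f = (k, \<lambda>x\<in>cube k. \<Sum>b\<in>UNIV. f (take i x @ b # drop i x))"

definition closed_under_operations :: "bfun set \<Rightarrow> bool" where
  "closed_under_operations G \<longleftrightarrow>
     (\<forall>k f i. (k, f) \<in> G \<and> i \<le> k \<longrightarrow> fictitious i k f \<in> G) \<and>
     (\<forall>k f \<pi>. (k, f) \<in> G \<and> \<pi> permutes {..<k} \<longrightarrow> permute_args \<pi> k f \<in> G) \<and>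
     (\<forall>k f g. (k, f) \<in> G \<and> (k, g) \<in> G \<longrightarrow> pointwise_product k f g \<in> G) \<and>
     (\<forall>k f i. (Suc k, f) \<in> G \<and> i \<le> k \<longrightarrow> sum_out i k f \<in> G)"

definition fclone :: "bfun set \<Rightarrow> bfun set" where
  "fclone F = closed_under_operations hull (insert EQ F)"

definition is_limit :: "nat \<Rightarrow> (bool list \<Rightarrow> real) \<Rightarrow> bfun set \<Rightarrow> bool" where
  "is_limit k f F \<longleftrightarrow> (k, f) \<in> Bfuns \<and>
     (\<exists>S. finite S \<and> S \<subseteq> F \<and>
       (\<forall>\<epsilon>>0. \<exists>f\<^sub>\<epsilon>. (k, f\<^sub>\<epsilon>) \<in> fclone S \<and> (MAX x\<in>cube k. \<bar>f x - f\<^sub>\<epsilon> x\<bar>) < \<epsilon>))"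

definition closed_under_limits :: "bfun set \<Rightarrow> bool" where
  "closed_under_limits G \<longleftrightarrow> (\<forall>k f. is_limit k f G \<longrightarrow> (k, f) \<in> G)"

definition oclone :: "bfun set \<Rightarrow> bfun set" where
  "oclone F = (\<lambda>G. closed_under_operations G \<and> closed_under_limits G) hull (insert EQ F)"

definition omega_clone :: "bfun set \<Rightarrow> bool" where
  "omega_clone G \<longleftrightarrow> G \<subseteq> Bfuns \<and> oclone G = G"

definition maximal_omega_clone_in :: "bfun set \<Rightarrow> bfun set \<Rightarrow> bool" where
  "maximal_omega_clone_in G H \<longleftrightarrow>
     omega_clone G \<and> omega_clone H \<and> G \<subset> H \<and>
     (\<forall>K. omega_clone K \<and> G \<subseteq> K \<and> K \<subseteq> H \<longrightarrow> K = G \<or> K = H)"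

end

theory Submission
  imports Defs
begin

text \<open>Nonnegativity of the Fourier transform survives products because products become
  convolutions, and the other operations and limits preserve it directly. In the other direction, a
  negative Fourier coefficient of \<open>f\<close> yields disequality \<open>NEQ\<close> as a limit. Disequality and \<open>SDP\<close> give
  every self-dual \<open>f\<close> of positive arity: \<open>f(x)\<close> is the value at \<open>y = \<not> x\<^sub>0\<close> of the combination, with
  weights \<open>f(a) / 2 \<ge> 0\<close>, of the indicators of the planes where each \<open>x\<^sub>i\<close> equals \<open>x\<^sub>0\<close> or \<open>y\<close>
  according to whether \<open>a\<^sub>i = a\<^sub>0\<close>. An indicator of a linear subspace has nonnegative Fourier
  transform, so this combination lies in \<open>SDP\<close>, and \<open>y\<close> is summed out against \<open>NEQ(y, x\<^sub>0)\<close>.\<close>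

section \<open>Points of the cube; inserting and deleting a coordinate\<close>

lemma cube_0 [simp]: "cube 0 = {[]}"
  by (auto simp: cube_def)

lemma finite_cube [simp]: "finite (cube k)"
  using finite_lists_length_eq[of "UNIV :: bool set" k] by (simp add: cube_def)

lemma cube_nonempty [simp]: "cube k \<noteq> {}"
  by (auto simp: cube_def intro: exI[of _ "replicate k True"])

lemma complement_in_cube [simp]: "complement x \<in> cube k \<longleftrightarrow> x \<in> cube k"
  by (simp add: cube_def complement_def)

lemma complement_complement [simp]: "complement (complement x) = x"
  by (simp add: complement_def comp_def)

lemma insert_at_in_cube:
  "i \<le> k \<Longrightarrow> w \<in> cube k \<Longrightarrow> take i w @ b # drop i w \<in> cube (Suc k)"
  by (simp add: cube_def)

lemma delete_at_in_cube:
  "i \<le> k \<Longrightarrow> w \<in> cube (Suc k) \<Longrightarrow> take i w @ drop (Suc i) w \<in> cube k"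
  by (simp add: cube_def)

lemma delete_insert_at:
  "i \<le> length w \<Longrightarrow>
    take i (take i w @ b # drop i w) @ drop (Suc i) (take i w @ b # drop i w) = w"
  by simp

lemma insert_delete_at:
  "i < length w \<Longrightarrow>
    take i (take i w @ drop (Suc i) w) @ w ! i # drop i (take i w @ drop (Suc i) w) = w"
  by (simp add: Cons_nth_drop_Suc)

lemma sum_cube_insert:
  assumes "i \<le> k"
  shows "(\<Sum>w\<in>cube (Suc k). F w) = (\<Sum>b\<in>UNIV. \<Sum>w\<in>cube k. F (take i w @ b # drop i w))"
proof -
  have "(\<Sum>w\<in>cube (Suc k). F w) = (\<Sum>(b, w)\<in>UNIV \<times> cube k. F (take i w @ b # drop i w))"
    by (rule sum.reindex_bij_witness
        [where i = "\<lambda>(b, w). take i w @ b # drop i w"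
           and j = "\<lambda>w. (w ! i, take i w @ drop (Suc i) w)"])
       (use assms in \<open>auto simp: cube_def nth_append Cons_nth_drop_Suc\<close>)
  then show ?thesis
    by (simp add: sum.cartesian_product)
qed

lemma sum_cube_Suc:
  "(\<Sum>w\<in>cube (Suc k). F w) = (\<Sum>b\<in>UNIV. \<Sum>w\<in>cube k. F (b # w))"
  using sum_cube_insert[of 0 k F] by simp

section \<open>Walsh characters of the cube under exclusive or\<close>

definition walsh :: "bool list \<Rightarrow> bool list \<Rightarrow> real" where
  "walsh w x = (-1) ^ hamming_weight (meet w x)"

lemma walsh_Nil [simp]: "walsh [] x = 1" "walsh w [] = 1"
  by (simp_all add: walsh_def meet_def hamming_weight_def)

lemma walsh_Cons [simp]:
  "walsh (b # w) (c # x) = (if b \<and> c then -1 else 1) * walsh w x"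
  by (simp add: walsh_def meet_def hamming_weight_def)

lemma walsh_append:
  "length w = length x \<Longrightarrow> walsh (w @ w') (x @ x') = walsh w x * walsh w' x'"
  by (induction w x rule: list_induct2) simp_all

lemma walsh_cases: "walsh w x = 1 \<or> walsh w x = -1"
  by (simp add: walsh_def) (metis neg_one_even_power neg_one_odd_power)

lemma walsh_commute: "walsh w x = walsh x w"
proof (induction w arbitrary: x)
  case (Cons b w)
  then show ?case by (cases x) auto
qed simp

lemma walsh_insert_at:
  assumes "w \<in> cube k" "x \<in> cube k" "i \<le> k"
  shows "walsh (take i w @ b # drop i w) (take i x @ c # drop i x)
    = (if b \<and> c then -1 else 1) * walsh w x"
proof -
  have "walsh w x = walsh (take i w) (take i x) * walsh (drop i w) (drop i x)"
    using assms walsh_append[of "take i w" "take i x" "drop i w" "drop i x"]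
    by (simp add: cube_def)
  then show ?thesis
    using assms by (simp add: cube_def walsh_append)
qed

lemma walsh_permute_list:
  assumes "\<pi> permutes {..<k}" "w \<in> cube k" "x \<in> cube k"
  shows "walsh (permute_list \<pi> w) (permute_list \<pi> x) = walsh w x"
proof -
  have "meet (permute_list \<pi> w) (permute_list \<pi> x) = permute_list \<pi> (meet w x)"
    using assms by (simp add: meet_def cube_def permute_list_zip permute_list_map)
  moreover have "mset (permute_list \<pi> (meet w x)) = mset (meet w x)"
    using assms by (intro mset_permute_list) (simp add: meet_def cube_def)
  ultimately show ?thesis
    by (simp add: walsh_def hamming_weight_def flip: count_mset)
qed

text \<open>Each position contributes a factor; complementing \<open>w\<close> flips it where
  \<open>x\<close> is True and leaves it at 1 elsewhere.\<close>

lemma walsh_complement: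
  assumes "length w = length x"
  shows "walsh (complement w) x = (-1) ^ hamming_weight x * walsh w x"
  using assms
  by (induction w x rule: list_induct2) (auto simp: complement_def hamming_weight_def)

lemma walsh_xor:
  assumes "length x = length w" "length w = length y"
  shows "walsh w (map2 (\<noteq>) x y) = walsh w x * walsh w y"
  using assms by (induction x w y rule: list_induct3) auto

text \<open>The sum factors over coordinates: a coordinate where \<open>v\<close> and
  \<open>w\<close> agree contributes 2, one where they differ contributes 1 - 1 = 0.\<close>

lemma walsh_orthogonal:
  "v \<in> cube k \<Longrightarrow> w \<in> cube k \<Longrightarrow>
    (\<Sum>x\<in>cube k. walsh x v * walsh x w) = (if v = w then 2 ^ k else 0)"
proof (induction k arbitrary: v w)
  case 0
  then show ?case by simp
next
  case (Suc k)
  then obtain b v' c w' where vw: "v = b # v'" "w = c # w'" "v' \<in> cube k" "w' \<in> cube k"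
    by (auto simp: cube_def length_Suc_conv)
  have "(\<Sum>x\<in>cube (Suc k). walsh x v * walsh x w)
    = (1 + (if b then -1 else 1) * (if c then -1 else 1)) * (\<Sum>x\<in>cube k. walsh x v' * walsh x w')"
    by (simp add: vw sum_cube_Suc UNIV_bool sum_negf)
  then show ?case
    using Suc.IH[OF vw(3,4)] by (auto simp: vw)
qed

section \<open>The Fourier transform and its inversion\<close>

lemma fourier_walsh: "fourier k f x = (\<Sum>w\<in>cube k. walsh w x * f w) / 2 ^ k"
  by (simp add: fourier_def walsh_def)

lemma fourier_nonneg_iff: "0 \<le> fourier k f x \<longleftrightarrow> 0 \<le> (\<Sum>w\<in>cube k. walsh w x * f w)"
  by (simp add: fourier_walsh divide_nonneg_pos pos_le_divide_eq)

lemma fourier_cong: "(\<And>w. w \<in> cube k \<Longrightarrow> f w = g w) \<Longrightarrow> fourier k f x = fourier k g x"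
  by (simp add: fourier_walsh)

lemma fourier_restrict [simp]: "fourier k (restrict f (cube k)) x = fourier k f x"
  by (rule fourier_cong) simp

lemma fourier_inversion:
  assumes "w \<in> cube k"
  shows "f w = (\<Sum>x\<in>cube k. fourier k f x * walsh w x)"
proof -
  have "(\<Sum>x\<in>cube k. fourier k f x * walsh w x)
      = (\<Sum>x\<in>cube k. \<Sum>v\<in>cube k. f v / 2 ^ k * (walsh x v * walsh x w))"
    unfolding fourier_walsh sum_divide_distrib sum_distrib_right
    by (intro sum.cong refl) (simp add: walsh_commute)
  also have "\<dots> = (\<Sum>v\<in>cube k. f v / 2 ^ k * (\<Sum>x\<in>cube k. walsh x v * walsh x w))"
    by (subst sum.swap) (simp add: sum_distrib_left)
  also have "\<dots> = (\<Sum>v\<in>cube k. if v = w then f v else 0)"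
    using assms by (intro sum.cong) (auto simp: walsh_orthogonal)
  also have "\<dots> = f w"
    using assms by simp
  finally show ?thesis ..
qed

section \<open>Self-dual functions and their Fourier coefficients\<close>

lemma SD_iff:
  "(k, f) \<in> SD \<longleftrightarrow> f \<in> cube k \<rightarrow>\<^sub>E {0..} \<and> (\<forall>x\<in>cube k. f (complement x) = f x)"
  by (auto simp: SD_def Bfuns_def)

lemma restrict_in_SD_iff:
  "(k, restrict f (cube k)) \<in> SD \<longleftrightarrow> (\<forall>x\<in>cube k. 0 \<le> f x \<and> f (complement x) = f x)"
  by (auto simp: SD_iff restrict_PiE_iff)

lemma SD_subset_Bfuns: "SD \<subseteq> Bfuns"
  unfolding SD_def by blast

lemma SD_nonneg: "(k, f) \<in> SD \<Longrightarrow> x \<in> cube k \<Longrightarrow> 0 \<le> f x"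
  by (auto simp: SD_iff)

lemma SD_complement: "(k, f) \<in> SD \<Longrightarrow> x \<in> cube k \<Longrightarrow> f (complement x) = f x"
  by (auto simp: SD_iff)

lemma SD_restrict: "(k, f) \<in> SD \<Longrightarrow> restrict f (cube k) = f"
  by (auto simp: SD_iff PiE_restrict)

text \<open>Reindexing by \<open>complement\<close> fixes \<open>f\<close> and negates a character
  of odd weight, so the sum equals its own negative.\<close>

lemma fourier_odd_self_dual:
  assumes "(k, f) \<in> SD" "x \<in> cube k" "odd (hamming_weight x)"
  shows "fourier k f x = 0"
proof -
  have "(\<Sum>w\<in>cube k. walsh w x * f w) = (\<Sum>w\<in>cube k. walsh (complement w) x * f (complement w))"
    by (rule sum.reindex_bij_witness[where i = complement and j = complement]) auto
  also have "\<dots> = - (\<Sum>w\<in>cube k. walsh w x * f w)"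
    using assms by (simp add: walsh_complement SD_complement cube_def sum_negf)
  finally show ?thesis
    by (simp add: fourier_walsh)
qed

text \<open>Odd Fourier coefficients of a self-dual function vanish, so membership in \<open>PN_funs\<close>
  imposes nothing beyond membership in \<open>P_funs\<close>.\<close>

lemma SDP_iff: "(k, f) \<in> SDP \<longleftrightarrow> (k, f) \<in> SD \<and> (\<forall>x\<in>cube k. 0 \<le> fourier k f x)"
proof
  assume "(k, f) \<in> SDP"
  then show "(k, f) \<in> SD \<and> (\<forall>x\<in>cube k. 0 \<le> fourier k f x)"
    by (simp add: SDP_def P_funs_def)
next
  assume f: "(k, f) \<in> SD \<and> (\<forall>x\<in>cube k. 0 \<le> fourier k f x)"
  then have "(k, f) \<in> Bfuns"
    by (simp add: SD_def)
  with f show "(k, f) \<in> SDP"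
    using fourier_odd_self_dual[of k f] by (simp add: SDP_def P_funs_def PN_funs_def)
qed

lemma SDP_subset_SD: "SDP \<subseteq> SD"
  by (auto simp: SDP_def)

section \<open>Closure of \<open>SD\<close> under the four operations\<close>

lemma closed_operationsD:
  assumes "closed_under_operations G"
  shows closed_fictitious: "(k, f) \<in> G \<Longrightarrow> i \<le> k \<Longrightarrow> fictitious i k f \<in> G"
    and closed_product: "(k, f) \<in> G \<Longrightarrow> (k, g) \<in> G \<Longrightarrow> pointwise_product k f g \<in> G"
    and closed_sum_out: "(Suc k, f) \<in> G \<Longrightarrow> i \<le> k \<Longrightarrow> sum_out i k f \<in> G"
  using assms unfolding closed_under_operations_def by blast+

lemma complement_simps [simp]:
  "complement (x # xs) = (\<not> x) # complement xs"
  "complement (xs @ ys) = complement xs @ complement ys"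
  "complement (take i xs) = take i (complement xs)"
  "complement (drop i xs) = drop i (complement xs)"
  by (simp_all add: complement_def take_map drop_map)

lemma permute_list_in_cube [simp]: "permute_list \<pi> x \<in> cube k \<longleftrightarrow> x \<in> cube k"
  by (simp add: cube_def)

lemma fictitious_SD: "(k, f) \<in> SD \<Longrightarrow> i \<le> k \<Longrightarrow> fictitious i k f \<in> SD"
  unfolding fictitious_def restrict_in_SD_iff
  using SD_nonneg[OF _ delete_at_in_cube] SD_complement[OF _ delete_at_in_cube] by fastforce

lemma permute_args_SD:
  assumes "(k, f) \<in> SD" "\<pi> permutes {..<k}"
  shows "permute_args \<pi> k f \<in> SD"
proof -
  have "permute_list \<pi> (complement x) = complement (permute_list \<pi> x)" if "x \<in> cube k" for x
    using assms(2) that by (simp add: complement_def permute_list_map cube_def)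
  with assms(1) show ?thesis
    unfolding permute_args_def restrict_in_SD_iff by (simp add: SD_nonneg SD_complement)
qed

lemma pointwise_product_SD:
  "(k, f) \<in> SD \<Longrightarrow> (k, g) \<in> SD \<Longrightarrow> pointwise_product k f g \<in> SD"
  unfolding pointwise_product_def restrict_in_SD_iff by (simp add: SD_nonneg SD_complement)

lemma sum_out_SD:
  assumes "(Suc k, f) \<in> SD" "i \<le> k"
  shows "sum_out i k f \<in> SD"
proof -
  have "(\<Sum>b\<in>UNIV. f (take i (complement x) @ b # drop i (complement x)))
      = (\<Sum>b\<in>UNIV. f (take i x @ b # drop i x))" if "x \<in> cube k" for x
  proof -
    \<comment> \<open>Self-duality matches the summand for \<open>b\<close> with the one for the
      negated bit, so complementing the other arguments swaps the two summands.\<close>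
    have "f (take i (complement x) @ (\<not> b) # drop i (complement x)) = f (take i x @ b # drop i x)" for b
      using SD_complement[OF assms(1) insert_at_in_cube[OF assms(2) that, of b]] by simp
    from this[of True] this[of False] show ?thesis
      by (simp add: UNIV_bool)
  qed
  with assms show ?thesis
    unfolding sum_out_def restrict_in_SD_iff
    by (auto intro!: sum_nonneg SD_nonneg[OF assms(1)] insert_at_in_cube)
qed

lemma closed_under_operations_SD: "closed_under_operations SD"
  unfolding closed_under_operations_def
  by (simp add: fictitious_SD permute_args_SD pointwise_product_SD sum_out_SD)

section \<open>Closure of \<open>SDP\<close> under the four operations\<close>

lemma fictitious_SDP:
  assumes "(k, f) \<in> SDP" "i \<le> k"
  shows "fictitious i k f \<in> SDP"
proof -
  have "0 \<le> fourier (Suc k) (\<lambda>x. f (take i x @ drop (Suc i) x)) z" if z: "z \<in> cube (Suc k)" for z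
  proof -
    define z' where "z' = take i z @ drop (Suc i) z"
    have z': "z' \<in> cube k" "z = take i z' @ z ! i # drop i z'"
      using assms(2) z insert_delete_at[of i z]
      by (auto simp: z'_def cube_def)
    have "(\<Sum>w\<in>cube (Suc k). walsh w z * f (take i w @ drop (Suc i) w))
      = (\<Sum>b\<in>UNIV. \<Sum>w\<in>cube k. walsh (take i w @ b # drop i w) (take i z' @ z ! i # drop i z') * f w)"
      unfolding sum_cube_insert[OF assms(2)] z'(2)[symmetric]
      by (intro sum.cong refl arg_cong2[of _ _ _ _ times] arg_cong[of _ _ f] delete_insert_at)
         (use assms(2) in \<open>auto simp: cube_def\<close>)
    \<comment> \<open>The signs add up to 0 if \<open>z ! i\<close> holds and to 2 otherwise: the
      coefficient either vanishes or is that of \<open>f\<close> at \<open>z'\<close>.\<close>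
    also have "\<dots> = (\<Sum>b\<in>UNIV. (if b \<and> z ! i then -1 else 1) * (\<Sum>w\<in>cube k. walsh w z' * f w))"
      using walsh_insert_at[OF _ z'(1) assms(2)] by (simp add: sum_distrib_left mult.assoc)
    also have "\<dots> \<ge> 0"
      using assms z'(1) by (auto simp: UNIV_bool SDP_iff fourier_nonneg_iff)
    finally show ?thesis
      by (simp add: fourier_nonneg_iff)
  qed
  then show ?thesis
    using assms fictitious_SD[of k f i] by (simp add: fictitious_def SDP_iff)
qed

text \<open>Characters are invariant under a simultaneous permutation of both lists, so permuting
  arguments only permutes the Fourier coefficients.\<close>

lemma permute_args_SDP:
  assumes "(k, f) \<in> SDP" and \<pi>: "\<pi> permutes {..<k}"
  shows "permute_args \<pi> k f \<in> SDP"
proof -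
  have inv: "permute_list \<pi> (permute_list (inv \<pi>) x) = x" "permute_list (inv \<pi>) (permute_list \<pi> x) = x"
    if "x \<in> cube k" for x
    using that \<pi> permute_list_compose[of \<pi> x "inv \<pi>"] permute_list_compose[of "inv \<pi>" x \<pi>]
    by (simp_all add: cube_def permutes_inv permutes_inv_o)
  have "0 \<le> fourier k (\<lambda>x. f (permute_list \<pi> x)) z" if z: "z \<in> cube k" for z
  proof -
    have "(\<Sum>w\<in>cube k. walsh w z * f (permute_list \<pi> w))
      = (\<Sum>w\<in>cube k. walsh w (permute_list \<pi> z) * f w)"
      by (rule sum.reindex_bij_witness
          [where i = "permute_list (inv \<pi>)" and j = "permute_list \<pi>"])
         (use \<pi> z inv in \<open>auto simp: walsh_permute_list\<close>)
    then show ?thesis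
      using assms(1) z by (simp add: fourier_walsh SDP_iff)
  qed
  then show ?thesis
    using assms permute_args_SD[of k f \<pi>] by (simp add: permute_args_def SDP_iff)
qed

text \<open>Expanding \<open>f\<close> by inversion and merging characters with
  \<open>walsh_xor\<close> writes the coefficient at \<open>z\<close> as the sum over
  \<open>x\<close> of the coefficient of \<open>f\<close> at \<open>x\<close> times that of
  \<open>g\<close> at the exclusive or of \<open>z\<close> and \<open>x\<close>.\<close>

lemma pointwise_product_SDP:
  assumes "(k, f) \<in> SDP" "(k, g) \<in> SDP"
  shows "pointwise_product k f g \<in> SDP"
proof -
  have "0 \<le> fourier k (\<lambda>x. f x * g x) z" if z: "z \<in> cube k" for z
  proof -
    have xor: "map2 (\<noteq>) z x \<in> cube k" if "x \<in> cube k" for x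
      using that z by (simp add: cube_def)
    have "(\<Sum>w\<in>cube k. walsh w z * (f w * g w))
      = (\<Sum>w\<in>cube k. \<Sum>x\<in>cube k. fourier k f x * (walsh w (map2 (\<noteq>) z x) * g w))"
    proof (rule sum.cong)
      fix w
      assume w: "w \<in> cube k"
      have "walsh w z * (f w * g w) = walsh w z * ((\<Sum>x\<in>cube k. fourier k f x * walsh w x) * g w)"
        using fourier_inversion[OF w] by simp
      also have "\<dots> = (\<Sum>x\<in>cube k. fourier k f x * (walsh w (map2 (\<noteq>) z x) * g w))"
        unfolding sum_distrib_left sum_distrib_right
        using w z by (intro sum.cong refl) (subst walsh_xor; simp add: cube_def)
      finally show "walsh w z * (f w * g w)
        = (\<Sum>x\<in>cube k. fourier k f x * (walsh w (map2 (\<noteq>) z x) * g w))" .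
    qed simp
    also have "\<dots> = (\<Sum>x\<in>cube k. fourier k f x * (\<Sum>w\<in>cube k. walsh w (map2 (\<noteq>) z x) * g w))"
      by (subst sum.swap) (simp add: sum_distrib_left)
    also have "\<dots> \<ge> 0"
    proof (rule sum_nonneg)
      fix x
      assume x: "x \<in> cube k"
      then have "0 \<le> fourier k f x" "0 \<le> fourier k g (map2 (\<noteq>) z x)"
        using assms xor[OF x] unfolding SDP_iff by blast+
      then show "0 \<le> fourier k f x * (\<Sum>w\<in>cube k. walsh w (map2 (\<noteq>) z x) * g w)"
        unfolding fourier_nonneg_iff[of k g] by (rule mult_nonneg_nonneg)
    qed
    finally show ?thesis
      by (simp add: fourier_nonneg_iff)
  qed
  then show ?thesis
    using assms pointwise_product_SD[of k f g] by (simp add: pointwise_product_def SDP_iff)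
qed

text \<open>An index with False at position \<open>i\<close> ignores the summed argument, so each
  new coefficient is twice a coefficient of \<open>f\<close>.\<close>

lemma sum_out_SDP:
  assumes "(Suc k, f) \<in> SDP" "i \<le> k"
  shows "sum_out i k f \<in> SDP"
proof -
  have "0 \<le> fourier k (\<lambda>x. \<Sum>b\<in>UNIV. f (take i x @ b # drop i x)) z" if z: "z \<in> cube k" for z
  proof -
    have "(\<Sum>w\<in>cube k. walsh w z * (\<Sum>b\<in>UNIV. f (take i w @ b # drop i w)))
      = (\<Sum>b\<in>UNIV. \<Sum>w\<in>cube k. walsh w z * f (take i w @ b # drop i w))"
      by (subst sum.swap) (simp add: sum_distrib_left)
    also have "\<dots> = (\<Sum>w\<in>cube (Suc k). walsh w (take i z @ False # drop i z) * f w)"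
      unfolding sum_cube_insert[OF assms(2)] using walsh_insert_at[OF _ z assms(2)] by simp
    also have "\<dots> \<ge> 0"
      using assms(1) insert_at_in_cube[OF assms(2) z] by (simp add: SDP_iff fourier_nonneg_iff)
    finally show ?thesis
      by (simp add: fourier_nonneg_iff)
  qed
  then show ?thesis
    using assms sum_out_SD[of k f i] by (simp add: sum_out_def SDP_iff)
qed

lemma closed_under_operations_SDP: "closed_under_operations SDP"
  unfolding closed_under_operations_def
  by (simp add: fictitious_SDP permute_args_SDP pointwise_product_SDP sum_out_SDP)

section \<open>Equality and disequality\<close>

definition NEQ :: bfun where
  "NEQ = (2, \<lambda>x\<in>cube 2. if x ! 0 = x ! 1 then 0 else 1)"

lemma cube_2_cases:
  assumes "x \<in> cube 2"
  obtains a b where "x = [a, b]"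
  using assms by (auto simp: cube_def length_Suc_conv numeral_2_eq_2)

lemma EQ_in_SDP: "EQ \<in> SDP"
proof -
  have "0 \<le> fourier 2 (\<lambda>x. if x ! 0 = x ! 1 then 1 else 0) z" if "z \<in> cube 2" for z
    using that by (rule cube_2_cases) (simp add: fourier_nonneg_iff numeral_2_eq_2 sum_cube_Suc UNIV_bool)
  then show ?thesis
    by (auto simp: EQ_def SDP_iff restrict_in_SD_iff elim: cube_2_cases)
qed

lemma NEQ_in_SD: "NEQ \<in> SD"
  by (auto simp: NEQ_def restrict_in_SD_iff elim: cube_2_cases)

lemma NEQ_notin_SDP: "NEQ \<notin> SDP"
proof -
  \<comment> \<open>The two points of the support both have character value -1 here, so the
    coefficient is -1/2.\<close>
  have "fourier 2 (\<lambda>x. if x ! 0 = x ! 1 then 0 else 1) [True, True] < 0"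
    by (simp add: fourier_walsh numeral_2_eq_2 sum_cube_Suc UNIV_bool)
  moreover have "[True, True] \<in> cube 2"
    by (simp add: cube_def)
  ultimately show ?thesis
    by (fastforce simp: NEQ_def SDP_iff)
qed

section \<open>Limits, and \<open>SD\<close> and \<open>SDP\<close> as omega-clones\<close>

lemma fclone_subset:
  "closed_under_operations G \<Longrightarrow> EQ \<in> G \<Longrightarrow> S \<subseteq> G \<Longrightarrow> fclone S \<subseteq> G"
  unfolding fclone_def by (intro hull_minimal) auto

text \<open>Errors below 1 / (n + 1) turn the approximations into a sequence, which stays in
  \<open>G\<close> because \<open>G\<close> contains the clone of each of its subsets.\<close>

lemma limit_sequence:
  assumes "is_limit k f G" "closed_under_operations G" "EQ \<in> G"
  obtains F where "\<And>n. (k, F n) \<in> G" "\<And>x. x \<in> cube k \<Longrightarrow> (\<lambda>n. F n x) \<longlonglongrightarrow> f x"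
proof -
  obtain S where S: "S \<subseteq> G"
    "\<And>\<epsilon>. \<epsilon> > 0 \<Longrightarrow> \<exists>g. (k, g) \<in> fclone S \<and> (MAX x\<in>cube k. \<bar>f x - g x\<bar>) < \<epsilon>"
    using assms(1) unfolding is_limit_def by blast
  have "\<forall>n. \<exists>g. (k, g) \<in> fclone S \<and> (MAX x\<in>cube k. \<bar>f x - g x\<bar>) < 1 / real (Suc n)"
    using S(2) by simp
  then obtain F where F: "\<And>n. (k, F n) \<in> fclone S"
    "\<And>n. (MAX x\<in>cube k. \<bar>f x - F n x\<bar>) < 1 / real (Suc n)"
    by metis
  show thesis
  proof
    show "(k, F n) \<in> G" for n
      using F(1) fclone_subset[OF assms(2,3) S(1)] by blast
    show "(\<lambda>n. F n x) \<longlonglongrightarrow> f x" if "x \<in> cube k" for x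
    proof -
      have "\<bar>f x - F n x\<bar> \<le> 1 / real (Suc n)" for n
        using F(2)[of n] that by (simp add: Max_less_iff less_imp_le)
      then have "(\<lambda>n. f x - F n x) \<longlonglongrightarrow> 0"
        by (intro tendsto_rabs_zero_cancel[OF tendsto_sandwich
              [OF _ _ tendsto_const LIMSEQ_Suc[OF lim_1_over_n]]] always_eventually) auto
      then have "(\<lambda>n. f x - (f x - F n x)) \<longlonglongrightarrow> f x - 0"
        by (intro tendsto_intros)
      then show ?thesis by simp
    qed
  qed
qed

lemma EQ_in_SD: "EQ \<in> SD"
  using EQ_in_SDP SDP_subset_SD by blast

lemma limit_in_SD:
  assumes "is_limit k f SD"
  shows "(k, f) \<in> SD"
proof -
  obtain F where F: "\<And>n. (k, F n) \<in> SD" "\<And>x. x \<in> cube k \<Longrightarrow> (\<lambda>n. F n x) \<longlonglongrightarrow> f x"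
    using limit_sequence[OF assms closed_under_operations_SD EQ_in_SD] by blast
  have "f (complement x) = f x" if "x \<in> cube k" for x
    using F(2)[of "complement x"] F(2)[of x] that
    by (intro LIMSEQ_unique[of "\<lambda>n. F n x"]) (simp_all add: SD_complement[OF F(1)])
  moreover have "(k, f) \<in> Bfuns"
    using assms by (simp add: is_limit_def)
  ultimately show ?thesis
    by (simp add: SD_iff Bfuns_def)
qed

text \<open>A Fourier coefficient is a finite sum, hence continuous in the values of
  \<open>f\<close>, and nonnegativity is a closed condition.\<close>

lemma limit_in_SDP:
  assumes "is_limit k f SDP"
  shows "(k, f) \<in> SDP"
proof -
  obtain F where F: "\<And>n. (k, F n) \<in> SDP" "\<And>x. x \<in> cube k \<Longrightarrow> (\<lambda>n. F n x) \<longlonglongrightarrow> f x"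
    using limit_sequence[OF assms closed_under_operations_SDP EQ_in_SDP] by blast
  have "is_limit k f SD"
    using assms SDP_subset_SD unfolding is_limit_def by blast
  moreover have "0 \<le> fourier k f x" if "x \<in> cube k" for x
  proof (rule LIMSEQ_le_const)
    show "(\<lambda>n. fourier k (F n) x) \<longlonglongrightarrow> fourier k f x"
      unfolding fourier_walsh by (intro tendsto_intros F(2)) simp_all
    show "\<exists>N. \<forall>n\<ge>N. 0 \<le> fourier k (F n) x"
      using F(1) that by (auto simp: SDP_iff)
  qed
  ultimately show ?thesis
    by (simp add: SDP_iff limit_in_SD)
qed

lemma oclone_minimal:
  "closed_under_operations G \<Longrightarrow> closed_under_limits G \<Longrightarrow> EQ \<in> G \<Longrightarrow> F \<subseteq> G \<Longrightarrow> oclone F \<subseteq> G"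
  unfolding oclone_def by (intro hull_minimal) auto

lemma oclone_superset: "insert EQ F \<subseteq> oclone F"
  unfolding oclone_def by (rule hull_subset)

lemma oclone_mono: "F \<subseteq> G \<Longrightarrow> oclone F \<subseteq> oclone G"
  unfolding oclone_def by (intro hull_mono) auto

lemma closed_under_operations_Inter:
  "(\<And>G. G \<in> A \<Longrightarrow> closed_under_operations G) \<Longrightarrow> closed_under_operations (\<Inter>A)"
  unfolding closed_under_operations_def by (intro conjI allI impI InterI) blast+

lemma closed_under_operations_oclone: "closed_under_operations (oclone F)"
  unfolding oclone_def hull_def by (rule closed_under_operations_Inter) blast

text \<open>\<open>is_limit\<close> is monotone in its set: the finite \<open>S\<close> found inside
  the intersection serves for every member.\<close>

lemma closed_under_limits_Inter:
  assumes "\<And>G. G \<in> A \<Longrightarrow> closed_under_limits G"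
  shows "closed_under_limits (\<Inter>A)"
proof -
  have "is_limit k f G" if "is_limit k f (\<Inter>A)" "G \<in> A" for k f G
    using that unfolding is_limit_def by (meson Inter_lower subset_trans)
  with assms show ?thesis
    unfolding closed_under_limits_def by blast
qed

lemma closed_under_limits_oclone: "closed_under_limits (oclone F)"
  unfolding oclone_def hull_def by (rule closed_under_limits_Inter) blast

lemma omega_cloneI:
  "G \<subseteq> Bfuns \<Longrightarrow> closed_under_operations G \<Longrightarrow> closed_under_limits G \<Longrightarrow> EQ \<in> G \<Longrightarrow> omega_clone G"
  unfolding omega_clone_def using oclone_minimal[of G G] oclone_superset[of G] by blast

lemma closed_under_limits_SD: "closed_under_limits SD"
  by (simp add: closed_under_limits_def limit_in_SD)

lemma omega_clone_SD: "omega_clone SD"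
  by (intro omega_cloneI SD_subset_Bfuns closed_under_operations_SD EQ_in_SD closed_under_limits_SD)

lemma omega_clone_SDP: "omega_clone SDP"
  using SDP_subset_SD SD_subset_Bfuns
  by (intro omega_cloneI closed_under_operations_SDP EQ_in_SDP)
     (auto simp: closed_under_limits_def limit_in_SDP)

section \<open>Derived operations: summing out a prefix, padding at the back, powers\<close>

lemma sum_out_front:
  assumes "closed_under_operations G" "(n + m, restrict f (cube (n + m))) \<in> G"
  shows "(m, \<lambda>y\<in>cube m. \<Sum>x\<in>cube n. f (x @ y)) \<in> G"
  using assms(2)
proof (induction n arbitrary: f)
  case (Suc n)
  have "sum_out 0 (n + m) (restrict f (cube (Suc n + m))) \<in> G"
    using closed_sum_out[OF assms(1), of "n + m"] Suc.prems by (simp del: restrict_apply)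
  moreover have "sum_out 0 (n + m) (restrict f (cube (Suc n + m)))
    = (n + m, restrict (\<lambda>x. \<Sum>b\<in>UNIV. f (b # x)) (cube (n + m)))"
    by (auto simp: sum_out_def cube_def intro!: restrict_ext)
  ultimately have "(m, \<lambda>y\<in>cube m. \<Sum>x\<in>cube n. \<Sum>b\<in>UNIV. f (b # x @ y)) \<in> G"
    using Suc.IH[of "\<lambda>x. \<Sum>b\<in>UNIV. f (b # x)"] by (simp del: restrict_apply)
  then show ?case
    by (simp add: sum_cube_Suc UNIV_bool sum.distrib del: restrict_apply)
qed (simp del: restrict_apply)

lemma fictitious_back:
  assumes "closed_under_operations G" "(k, restrict f (cube k)) \<in> G"
  shows "(k + j, \<lambda>x\<in>cube (k + j). f (take k x)) \<in> G"
proof (induction j)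
  case 0
  have "(\<lambda>x\<in>cube k. f (take k x)) = restrict f (cube k)"
    by (auto simp: cube_def intro!: restrict_ext)
  with assms show ?case by (simp del: restrict_apply)
next
  case (Suc j)
  have "fictitious (k + j) (k + j) (\<lambda>x\<in>cube (k + j). f (take k x))
    = (k + Suc j, \<lambda>x\<in>cube (k + Suc j). f (take k x))"
    by (auto simp: fictitious_def cube_def intro!: restrict_ext)
  then show ?case
    using closed_fictitious[OF assms(1) Suc.IH, of "k + j"] by (simp del: restrict_apply)
qed

lemma closed_product_restrict:
  assumes "closed_under_operations G"
    "(k, restrict f (cube k)) \<in> G" "(k, restrict g (cube k)) \<in> G"
  shows "(k, \<lambda>x\<in>cube k. f x * g x) \<in> G"
proof -
  have "pointwise_product k (restrict f (cube k)) (restrict g (cube k)) = (k, \<lambda>x\<in>cube k. f x * g x)"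
    by (auto simp: pointwise_product_def intro!: restrict_ext)
  then show ?thesis
    using closed_product[OF assms] by simp
qed

text \<open>Exponents start at 1, since products of \<open>f\<close> with itself do not yield the
  constant 1.\<close>

lemma closed_power:
  assumes "closed_under_operations G" "(k, restrict f (cube k)) \<in> G"
  shows "(k, \<lambda>x\<in>cube k. f x ^ Suc m) \<in> G"
proof (induction m)
  case (Suc m)
  then show ?case
    using closed_product_restrict[OF assms(1,2) Suc.IH] by (simp del: restrict_apply)
qed (use assms in \<open>simp del: restrict_apply\<close>)

section \<open>Disequality from a negative Fourier coefficient\<close>

lemma NEQ_is_limit:
  assumes G: "(2, \<lambda>x\<in>cube 2. if x ! 0 = x ! 1 then c else 1) \<in> G" and c: "0 \<le> c" "c < 1"
  shows "is_limit 2 (\<lambda>x\<in>cube 2. if x ! 0 = x ! 1 then 0 else 1) G"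
proof -
  define g where "g = (\<lambda>x :: bool list. if x ! 0 = x ! 1 then c else 1)"
  let ?C = "fclone {(2, restrict g (cube 2))}"
  have C: "closed_under_operations ?C" "(2, restrict g (cube 2)) \<in> ?C"
    unfolding fclone_def hull_def by (rule closed_under_operations_Inter, blast) blast
  show ?thesis
    unfolding is_limit_def
  proof (intro conjI exI[of _ "{(2, restrict g (cube 2))}"] allI impI)
    show "(2, \<lambda>x\<in>cube 2. if x ! 0 = x ! 1 then 0 else 1) \<in> Bfuns"
      using NEQ_in_SD SD_subset_Bfuns by (auto simp: NEQ_def)
    show "finite {(2 :: nat, restrict g (cube 2))}" "{(2, restrict g (cube 2))} \<subseteq> G"
      using G by (simp_all add: g_def)
    fix \<epsilon> :: real
    assume "\<epsilon> > 0"
    \<comment> \<open>Powers of \<open>g\<close> stay 1 on unequal arguments and decay on equal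
      ones, so \<open>c ^ Suc m\<close> is the whole error.\<close>
    then obtain m where m: "c ^ m < \<epsilon>"
      using real_arch_pow_inv c(2) by blast
    \<comment> \<open>\<open>m\<close> may be 0, while \<open>closed_power\<close> supplies positive
      exponents only.\<close>
    have "c ^ Suc m \<le> c ^ m"
      using c by (simp add: mult_left_le_one_le)
    with m have m': "c ^ Suc m < \<epsilon>"
      by linarith
    have "(2, \<lambda>x\<in>cube 2. g x ^ Suc m) \<in> ?C"
      using C by (rule closed_power)
    moreover have "(MAX x\<in>cube 2. \<bar>(\<lambda>x\<in>cube 2. if x ! 0 = x ! 1 then 0 else 1) x
        - (\<lambda>x\<in>cube 2. g x ^ Suc m) x\<bar>) < \<epsilon>"
      using m' c \<open>\<epsilon> > 0\<close> by (simp add: g_def abs_mult)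
    ultimately show "\<exists>f. (2, f) \<in> ?C \<and>
        (MAX x\<in>cube 2. \<bar>(\<lambda>x\<in>cube 2. if x ! 0 = x ! 1 then 0 else 1) x - f x\<bar>) < \<epsilon>"
      by blast
  qed
qed

text \<open>The constant 1 is the character of the zero vector, so by orthogonality the transform is
  supported on 0 and \<open>a\<close> with nonnegative values. Even weight of \<open>a\<close> makes
  its character self-dual.\<close>

lemma affine_character_in_SDP:
  assumes a: "a \<in> cube k" "even (hamming_weight a)" and "r \<ge> 0"
  shows "(k, \<lambda>x\<in>cube k. r * (1 + walsh x a)) \<in> SDP"
proof -
  have "0 \<le> fourier k (\<lambda>x. r * (1 + walsh x a)) z" if z: "z \<in> cube k" for z
  proof -
    have zero: "replicate k False \<in> cube k" "walsh w (replicate k False) = 1" for w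
      by (simp_all add: cube_def) (induction w arbitrary: k; case_tac k; simp)
    have "(\<Sum>w\<in>cube k. walsh w z * (r * (1 + walsh w a)))
      = r * ((\<Sum>w\<in>cube k. walsh w z * walsh w (replicate k False))
        + (\<Sum>w\<in>cube k. walsh w z * walsh w a))"
      by (simp add: zero(2) algebra_simps sum.distrib sum_distrib_left)
    also have "\<dots> \<ge> 0"
      using assms z zero(1) by (simp only: walsh_orthogonal) simp
    finally show ?thesis
      by (simp add: fourier_nonneg_iff)
  qed
  moreover have "(k, \<lambda>x\<in>cube k. r * (1 + walsh x a)) \<in> SD"
  proof -
    have "0 \<le> 1 + walsh x a" for x
      using walsh_cases[of x a] by auto
    moreover have "walsh (complement x) a = walsh x a" if "x \<in> cube k" for x
      using that a by (simp add: walsh_complement cube_def)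
    ultimately show ?thesis
      using \<open>r \<ge> 0\<close> by (simp add: restrict_in_SD_iff)
  qed
  ultimately show ?thesis
    by (simp add: SDP_iff)
qed

text \<open>Contracting \<open>f\<close> with \<open>r (1 + \<chi>\<^sub>a(x) \<chi>\<^sub>1\<^sub>1(y))\<close>, where \<open>a\<close> carries a negative Fourier coefficient,
  leaves a multiple of \<open>f\<^sub>0 + f\<^sub>a \<chi>\<^sub>1\<^sub>1(y)\<close> (with \<open>f\<^sub>0, f\<^sub>a\<close> the coefficients at \<open>0\<close> and \<open>a\<close>). This is
  larger on unequal than on equal arguments, so its normalised powers tend to \<open>NEQ\<close>.\<close>

lemma NEQ_in_closed:
  assumes G: "closed_under_operations G" "closed_under_limits G" "SDP \<subseteq> G"
    and f: "(n, f) \<in> SD - SDP" "(n, f) \<in> G"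
  shows "NEQ \<in> G"
proof -
  obtain a where a: "a \<in> cube n" "fourier n f a < 0"
    using f by (auto simp: SDP_iff not_le)
  then have even: "even (hamming_weight a)"
    using fourier_odd_self_dual[of n f a] f by fastforce
  define p where "p = (\<Sum>x\<in>cube n. f x)"
  define q where "q = (\<Sum>x\<in>cube n. walsh x a * f x)"
  have q: "q < 0"
    using a(2) by (simp add: fourier_walsh q_def divide_less_0_iff)
  \<comment> \<open>Characters are at least -1; the resulting bound keeps the value on equal
    arguments nonnegative.\<close>
  have "0 \<le> (\<Sum>x\<in>cube n. (1 + walsh x a) * f x)"
  proof (intro sum_nonneg mult_nonneg_nonneg)
    show "0 \<le> 1 + walsh x a" for x
      using walsh_cases[of x a] by auto
  qed (use f SD_nonneg in blast)
  then have pq: "0 \<le> p + q"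
    by (simp add: p_def q_def distrib_right sum.distrib)
  \<comment> \<open>Chosen to make the value on unequal arguments \<open>r * (p - q) = 1\<close>;
    the value on equal ones is then (p + q) / (p - q), below 1 as \<open>q < 0\<close>.\<close>
  define r where "r = 1 / (p - q)"
  have r: "r > 0" "r * (p - q) = 1"
    using q pq by (simp_all add: r_def)
  \<comment> \<open>The two appended bits keep the weight even and contribute the sign 1 if the last
    two arguments agree, -1 otherwise.\<close>
  define h where "h = (\<lambda>x. r * (1 + walsh x (a @ [True, True])))"
  have "(n + 2, restrict h (cube (n + 2))) \<in> G"
    unfolding h_def using a even r G(3)
    by (intro subsetD[OF G(3)] affine_character_in_SDP) (auto simp: cube_def hamming_weight_def)
  moreover have "(n + 2, \<lambda>x\<in>cube (n + 2). f (take n x)) \<in> G"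
    using f by (intro fictitious_back[OF G(1)]) (simp add: SD_restrict)
  ultimately have "(n + 2, \<lambda>x\<in>cube (n + 2). h x * f (take n x)) \<in> G"
    by (rule closed_product_restrict[OF G(1)])
  then have "(2, \<lambda>y\<in>cube 2. \<Sum>x\<in>cube n. h (x @ y) * f (take n (x @ y))) \<in> G"
    by (rule sum_out_front[OF G(1)])
  moreover have "(\<lambda>y\<in>cube 2. \<Sum>x\<in>cube n. h (x @ y) * f (take n (x @ y)))
    = (\<lambda>y\<in>cube 2. if y ! 0 = y ! 1 then r * (p + q) else 1)"
  proof (rule restrict_ext)
    fix y
    assume "y \<in> cube 2"
    then obtain b c where y: "y = [b, c]"
      by (rule cube_2_cases)
    have "(\<Sum>x\<in>cube n. h (x @ y) * f (take n (x @ y)))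
      = (\<Sum>x\<in>cube n. r * (f x + (if b = c then 1 else -1) * (walsh x a * f x)))"
      using a(1) by (intro sum.cong) (auto simp: h_def y cube_def walsh_append algebra_simps)
    also have "\<dots> = r * (p + (if b = c then 1 else -1) * q)"
      by (simp add: p_def q_def sum.distrib sum_distrib_left distrib_left)
    finally show "(\<Sum>x\<in>cube n. h (x @ y) * f (take n (x @ y)))
      = (if y ! 0 = y ! 1 then r * (p + q) else 1)"
      using r(2) by (simp add: y)
  qed
  ultimately have "(2, \<lambda>y\<in>cube 2. if y ! 0 = y ! 1 then r * (p + q) else 1) \<in> G"
    by simp
  moreover have "0 \<le> r * (p + q)" "r * (p + q) < 1"
    using r q pq by (simp_all add: r_def)
  ultimately show ?thesis
    using NEQ_is_limit G(2) unfolding closed_under_limits_def NEQ_def by blast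
qed

section \<open>Self-dual functions from \<open>SDP\<close> and disequality\<close>

definition plane :: "bool list \<Rightarrow> bool \<Rightarrow> bool \<Rightarrow> bool list" where
  "plane a s t = s # map (\<lambda>b. if b = hd a then t else s) a"

lemma plane_in_cube: "a \<in> cube k \<Longrightarrow> plane a s t \<in> cube (Suc k)"
  by (simp add: plane_def cube_def)

lemma complement_plane: "complement (plane a s t) = plane a (\<not> s) (\<not> t)"
  by (simp add: plane_def complement_def)

lemma walsh_map_if:
  "walsh (map (\<lambda>b. if b = c then t else s) a) z
    = (if s then walsh (map (\<lambda>b. b \<noteq> c) a) z else 1) * (if t then walsh (map (\<lambda>b. b = c) a) z else 1)"
proof (induction a arbitrary: z)
  case (Cons b a)
  show ?case
  proof (cases z)
    case (Cons d z')
    then show ?thesis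
      using Cons.IH[of z'] by (cases s; cases t) auto
  qed simp
qed simp

text \<open>On a plane parametrised by the bits \<open>s\<close> and \<open>t\<close> a character
  splits into a sign \<open>p\<close> for \<open>s\<close> and a sign \<open>q\<close> for
  \<open>t\<close>, so the sum is (1 + p)(1 + q).\<close>

lemma sum_walsh_plane_nonneg: "0 \<le> (\<Sum>s\<in>UNIV. \<Sum>t\<in>UNIV. walsh (plane a s t) z)"
proof (cases z)
  case (Cons d z')
  define p where "p = (if d then -1 else 1) * walsh (map (\<lambda>b. b \<noteq> hd a) a) z'"
  define q where "q = walsh (map (\<lambda>b. b = hd a) a) z'"
  have "(\<Sum>s\<in>UNIV. \<Sum>t\<in>UNIV. walsh (plane a s t) z) = (1 + p) * (1 + q)"
    by (simp add: plane_def Cons UNIV_bool walsh_map_if p_def q_def algebra_simps)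
  also have "\<dots> \<ge> 0"
    using walsh_cases[of "map (\<lambda>b. b \<noteq> hd a) a" z'] walsh_cases[of "map (\<lambda>b. b = hd a) a" z']
    by (auto simp: p_def q_def)
  finally show ?thesis .
qed (simp add: UNIV_bool)

text \<open>For nonempty \<open>a\<close>, the mapped list is whichever of \<open>a\<close> and
  \<open>complement a\<close> has the same head as \<open>x\<close>.\<close>

lemma map_if_hd_eq_iff:
  assumes "x \<noteq> []"
  shows "map (\<lambda>b. if b = hd a then hd x else \<not> hd x) a = x \<longleftrightarrow> a = x \<or> a = complement x"
proof (cases "hd a = hd x")
  case True
  then have "map (\<lambda>b. if b = hd a then hd x else \<not> hd x) a = a"
    by (intro map_idI) auto
  moreover have "a \<noteq> complement x"
    using True assms by (auto simp: complement_def hd_map)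
  ultimately show ?thesis by simp
next
  case False
  then have "map (\<lambda>b. if b = hd a then hd x else \<not> hd x) a = complement a"
    unfolding complement_def by (intro map_cong) auto
  moreover have "a \<noteq> x" "complement a = x \<longleftrightarrow> a = complement x"
    using False by auto
  ultimately show ?thesis by simp
qed

text \<open>The front bit forces \<open>s\<close>, and the entry coming from \<open>hd a\<close>
  forces \<open>t = hd x\<close>. As these differ, the pattern determines \<open>a\<close> up to
  complement.\<close>

lemma plane_eq_iff:
  assumes "x \<noteq> []"
  shows "(\<not> hd x) # x = plane a s t \<longleftrightarrow> s = (\<not> hd x) \<and> t = hd x \<and> (a = x \<or> a = complement x)"
proof -
  have t: "hd x = t" if "x = map (\<lambda>b. if b = hd a then t else s) a"
    using that assms by (cases a) auto
  have "(\<not> hd x) # x = plane a s t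
    \<longleftrightarrow> s = (\<not> hd x) \<and> x = map (\<lambda>b. if b = hd a then t else s) a"
    unfolding plane_def by auto
  also have "\<dots> \<longleftrightarrow> s = (\<not> hd x) \<and> t = hd x \<and> map (\<lambda>b. if b = hd a then hd x else \<not> hd x) a = x"
  proof (cases "t = hd x")
    case True
    then show ?thesis by (auto simp: eq_commute[of x])
  qed (use t in blast)
  finally show ?thesis
    unfolding map_if_hd_eq_iff[OF assms] .
qed

text \<open>The new argument y comes first and has value \<open>s\<close>; \<open>t\<close> is the
  value of x_0. The weight is halved because \<open>a\<close> and \<open>complement a\<close>
  describe the same plane.\<close>

definition extension :: "nat \<Rightarrow> (bool list \<Rightarrow> real) \<Rightarrow> bool list \<Rightarrow> real" where
  "extension k f w =
    (\<Sum>a\<in>cube k. \<Sum>s\<in>UNIV. \<Sum>t\<in>UNIV. if w = plane a s t then f a / 2 else 0)"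

text \<open>Complementing permutes the points of each plane, which gives self-duality. Moving the
  sum over \<open>w\<close> innermost leaves the character sums of the planes with weights
  \<open>f a / 2\<close>.\<close>

lemma extension_in_SDP:
  assumes "(k, f) \<in> SD"
  shows "(Suc k, restrict (extension k f) (cube (Suc k))) \<in> SDP"
proof -
  have nonneg: "0 \<le> f a" if "a \<in> cube k" for a
    using assms that by (rule SD_nonneg)
  have "complement w = plane a s t \<longleftrightarrow> w = plane a (\<not> s) (\<not> t)" for w a s t
    using complement_plane complement_complement by metis
  then have "extension k f (complement w) = extension k f w" for w
    by (simp add: extension_def UNIV_bool add_ac)
  then have "(Suc k, restrict (extension k f) (cube (Suc k))) \<in> SD"
    by (auto simp: restrict_in_SD_iff extension_def nonneg intro!: sum_nonneg)
  moreover have "0 \<le> fourier (Suc k) (extension k f) z" for z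
  proof -
    have "(\<Sum>w\<in>cube (Suc k). walsh w z * extension k f w)
      = (\<Sum>w\<in>cube (Suc k). \<Sum>a\<in>cube k. \<Sum>s\<in>UNIV. \<Sum>t\<in>UNIV.
          if w = plane a s t then walsh w z * (f a / 2) else 0)"
      by (simp add: extension_def sum_distrib_left if_distrib cong: if_cong)
    also have "\<dots> = (\<Sum>a\<in>cube k. \<Sum>s\<in>UNIV. \<Sum>t\<in>UNIV. \<Sum>w\<in>cube (Suc k).
          if w = plane a s t then walsh w z * (f a / 2) else 0)"
      by (subst sum.swap, intro sum.cong refl, subst sum.swap, intro sum.cong refl, rule sum.swap)
    also have "\<dots> = (\<Sum>a\<in>cube k. f a / 2 * (\<Sum>s\<in>UNIV. \<Sum>t\<in>UNIV. walsh (plane a s t) z))"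
      by (simp add: plane_in_cube sum_distrib_left mult.commute)
    also have "\<dots> \<ge> 0"
      by (intro sum_nonneg mult_nonneg_nonneg sum_walsh_plane_nonneg) (simp add: nonneg)
    finally show ?thesis
      by (simp add: fourier_nonneg_iff)
  qed
  ultimately show ?thesis
    by (simp add: SDP_iff)
qed

text \<open>Only the planes of \<open>x\<close> and \<open>complement x\<close> meet this point. For
  positive arity these two lists are distinct, and each contributes \<open>f x / 2\<close>.\<close>

lemma extension_restricts:
  assumes "(k, f) \<in> SD" "x \<in> cube k" "k > 0"
  shows "extension k f ((\<not> hd x) # x) = f x"
proof -
  have "x \<noteq> complement x"
    using assms by (cases x) (auto simp: cube_def)
  have "extension k f ((\<not> hd x) # x)
    = (\<Sum>a\<in>cube k. if a = x \<or> a = complement x then f a / 2 else 0)"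
    unfolding extension_def
  proof (rule sum.cong)
    fix a
    have *: "x \<noteq> []"
      using assms by (auto simp: cube_def)
    show "(\<Sum>s\<in>UNIV. \<Sum>t\<in>UNIV. if (\<not> hd x) # x = plane a s t then f a / 2 else 0)
      = (if a = x \<or> a = complement x then f a / 2 else 0)"
      unfolding plane_eq_iff[OF *] by (auto simp: UNIV_bool)
  qed simp
  also have "\<dots> = (\<Sum>a\<in>{x, complement x}. f a / 2)"
    using assms by (intro sum.mono_neutral_cong_right) auto
  also have "\<dots> = f x"
    using assms \<open>x \<noteq> complement x\<close> by (simp add: SD_complement)
  finally show ?thesis .
qed

lemma SD_subset_closed:
  assumes G: "closed_under_operations G" "SDP \<subseteq> G" "NEQ \<in> G"
  shows "SD \<subseteq> G"
proof
  fix g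
  assume "g \<in> SD"
  then obtain k f where g: "g = (k, f)" and f: "(k, f) \<in> SD"
    by (cases g) auto
  show "g \<in> G"
  proof (cases k)
    case 0
    \<comment> \<open>With no argument x_0 to compare with, arity 0 is separate: the only
      coefficient is the value itself.\<close>
    then have "(k, f) \<in> SDP"
      using f SD_nonneg[OF f, of "[]"] by (simp add: SDP_iff fourier_walsh)
    then show ?thesis
      using G(2) g by blast
  next
    case (Suc j)
    let ?neq = "\<lambda>x :: bool list. if x ! 0 = x ! 1 then 0 else 1 :: real"
    \<comment> \<open>As \<open>k = Suc j\<close>, the arity \<open>2 + j\<close> is
      \<open>1 + k\<close>: the front bit and the \<open>k\<close> arguments of
      \<open>f\<close>.\<close>
    have "(2 + j, \<lambda>x\<in>cube (2 + j). ?neq (take 2 x)) \<in> G"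
      using G(3) by (intro fictitious_back[OF G(1)]) (simp add: NEQ_def)
    moreover have "(2 + j, restrict (extension k f) (cube (2 + j))) \<in> G"
      using extension_in_SDP[OF f] G(2) Suc by auto
    ultimately have "(1 + k, \<lambda>x\<in>cube (1 + k). ?neq (take 2 x) * extension k f x) \<in> G"
      using closed_product_restrict[OF G(1)] Suc by fastforce
    \<comment> \<open>The disequality factor leaves only the summand whose front bit is
      \<open>\<not> hd y\<close>.\<close>
    then have "(k, \<lambda>y\<in>cube k. \<Sum>x\<in>cube 1. ?neq (take 2 (x @ y)) * extension k f (x @ y)) \<in> G"
      by (rule sum_out_front[OF G(1)])
    moreover have "(\<lambda>y\<in>cube k. \<Sum>x\<in>cube 1. ?neq (take 2 (x @ y)) * extension k f (x @ y)) = restrict f (cube k)"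
    proof (rule restrict_ext)
      fix y
      assume y: "y \<in> cube k"
      then obtain b y' where b: "y = b # y'"
        using Suc by (auto simp: cube_def length_Suc_conv)
      have "(\<Sum>x\<in>cube 1. ?neq (take 2 (x @ y)) * extension k f (x @ y)) = extension k f ((\<not> hd y) # y)"
        by (cases b) (simp_all add: sum_cube_Suc UNIV_bool b)
      then show "(\<Sum>x\<in>cube 1. ?neq (take 2 (x @ y)) * extension k f (x @ y)) = f y"
        using extension_restricts[OF f y] Suc by simp
    qed
    ultimately show ?thesis
      using g SD_restrict[OF f] by simp
  qed
qed

section \<open>Maximality of \<open>SDP\<close> in \<open>SD\<close>\<close>

lemma oclone_SDP_insert:
  assumes "(n, f) \<in> SD - SDP"
  shows "oclone (SDP \<union> {(n, f)}) = SD"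
proof
  show "oclone (SDP \<union> {(n, f)}) \<subseteq> SD"
    using assms SDP_subset_SD
    by (intro oclone_minimal closed_under_operations_SD closed_under_limits_SD EQ_in_SD) auto
  show "SD \<subseteq> oclone (SDP \<union> {(n, f)})"
    using oclone_superset[of "SDP \<union> {(n, f)}"]
    by (intro SD_subset_closed NEQ_in_closed[OF _ _ _ assms]
        closed_under_operations_oclone closed_under_limits_oclone) auto
qed

theorem theorem7p14:
  shows "maximal_omega_clone_in SDP SD \<and>
    (\<forall>n f. (n, f) \<in> SD - SDP \<longrightarrow> oclone (SDP \<union> {(n, f)}) = SD)"
proof -
  have "K = SD" if K: "omega_clone K" "SDP \<subseteq> K" "K \<subseteq> SD" "K \<noteq> SDP" for K
  proof -
    \<comment> \<open>One element of \<open>K\<close> outside \<open>SDP\<close> already generates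
      \<open>SD\<close> together with \<open>SDP\<close>, and \<open>K\<close> equals its own
      closure.\<close>
    obtain n f where nf: "(n, f) \<in> K" "(n, f) \<notin> SDP"
      using K by auto
    then have "oclone (SDP \<union> {(n, f)}) \<subseteq> oclone K"
      using K by (intro oclone_mono) auto
    then show ?thesis
      using nf K oclone_SDP_insert[of n f] by (auto simp: omega_clone_def)
  qed
  moreover have "SDP \<subset> SD"
    using SDP_subset_SD NEQ_in_SD NEQ_notin_SDP by blast
  ultimately show ?thesis
    unfolding maximal_omega_clone_in_def
    using omega_clone_SD omega_clone_SDP oclone_SDP_insert by blast
qed

end
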